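(* Let $\mathcal{F}$ be a class of simple finite graphs that is closed under taking subgraphs. Suppose that every $G\in\mathcal{F}$ satisfies $\chi''(G)\leq \Delta(G)+2$. Then Hadwiger's conjecture holds for every graph in $T(\mathcal{F})=\{T(G): G\in\mathcal{F}\}$, i.e. for every $G\in\mathcal{F}$ and every integer $t>0$, if $\chi(T(G))\geq t$ then $T(G)$ contains $K_t$ as a minor.
   Context: $\Delta(G)$ is the maximum degree of $G$. A total coloring of $G$ assigns colors to $V(G)\cup E(G)$ so that adjacent vertices, adjacent edges, and an edge and either of its endpoints always receive distinct colors; $\chi''(G)$ is the minimum number of colors in a total coloring. The total graph $T(G)$ has vertex set $V(G)\cup E(G)$, two elements being adjacent in $T(G)$ if they are adjacent vertices, adjacent edges (sharing an endpoint), or an edge and one of its endpoints in $G$. A graph $H$ is a minor of $G$ if a graph isomorphic to $H$ can be obtained from $G$ by vertex deletions, edge deletions and edge contractions. *)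

theory Defs
  imports Main
begin

text \<open>
  Undirected graphs are given by a vertex set and a set of two-element vertex sets.
  The null graph (no vertices) counts as a simple graph.
\<close>

record 'a ugraph =
  verts :: "'a set"
  edges :: "'a set set"

definition simple_graph :: "'a ugraph \<Rightarrow> bool" where
  "simple_graph G \<longleftrightarrow>
     finite (verts G) \<and> (\<forall>e\<in>edges G. e \<subseteq> verts G \<and> card e = 2)"

definition subgraph :: "'a ugraph \<Rightarrow> 'a ugraph \<Rightarrow> bool" where
  "subgraph H G \<longleftrightarrow> simple_graph H \<and> verts H \<subseteq> verts G \<and> edges H \<subseteq> edges G"

definition subgraph_closed :: "'a ugraph set \<Rightarrow> bool" where
  "subgraph_closed \<F> \<longleftrightarrow> (\<forall>G\<in>\<F>. \<forall>H. subgraph H G \<longrightarrow> H \<in> \<F>)"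

definition degree :: "'a ugraph \<Rightarrow> 'a \<Rightarrow> nat" where
  "degree G v = card {e \<in> edges G. v \<in> e}"

text \<open>Inserting 0 only matters for the null graph, which gets maximum degree 0.\<close>

definition max_degree :: "'a ugraph \<Rightarrow> nat" where
  "max_degree G = Max (insert 0 (degree G ` verts G))"

definition proper_coloring :: "'a ugraph \<Rightarrow> nat \<Rightarrow> ('a \<Rightarrow> nat) \<Rightarrow> bool" where
  "proper_coloring G k c \<longleftrightarrow>
     (\<forall>v\<in>verts G. c v < k) \<and>
     (\<forall>u v. {u, v} \<in> edges G \<longrightarrow> c u \<noteq> c v)"

definition chromatic_number :: "'a ugraph \<Rightarrow> nat" where
  "chromatic_number G = (LEAST k. \<exists>c. proper_coloring G k c)"

text \<open>
  A vertex \<open>v\<close> and an edge \<open>e\<close>, viewed as elements of the disjoint union of the vertex set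
  and the edge set, are written \<open>Inl v\<close> and \<open>Inr e\<close>.
\<close>

definition total_coloring :: "'a ugraph \<Rightarrow> nat \<Rightarrow> ('a + 'a set \<Rightarrow> nat) \<Rightarrow> bool" where
  "total_coloring G k c \<longleftrightarrow>
     (\<forall>v\<in>verts G. c (Inl v) < k) \<and>
     (\<forall>e\<in>edges G. c (Inr e) < k) \<and>
     (\<forall>u v. {u, v} \<in> edges G \<longrightarrow> c (Inl u) \<noteq> c (Inl v)) \<and>
     (\<forall>e\<in>edges G. \<forall>f\<in>edges G. e \<noteq> f \<and> e \<inter> f \<noteq> {} \<longrightarrow> c (Inr e) \<noteq> c (Inr f)) \<and>
     (\<forall>e\<in>edges G. \<forall>v\<in>e. c (Inl v) \<noteq> c (Inr e))"

definition total_chromatic_number :: "'a ugraph \<Rightarrow> nat" where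
  "total_chromatic_number G = (LEAST k. \<exists>c. total_coloring G k c)"

definition total_graph :: "'a ugraph \<Rightarrow> ('a + 'a set) ugraph" where
  "total_graph G =
     \<lparr>verts = Inl ` verts G \<union> Inr ` edges G,
      edges = {{Inl u, Inl v} | u v. {u, v} \<in> edges G} \<union>
              {{Inr e, Inr f} | e f. e \<in> edges G \<and> f \<in> edges G \<and> e \<noteq> f \<and> e \<inter> f \<noteq> {}} \<union>
              {{Inl v, Inr e} | v e. e \<in> edges G \<and> v \<in> e}\<rparr>"

definition isomorphic :: "'a ugraph \<Rightarrow> 'b ugraph \<Rightarrow> bool" where
  "isomorphic G H \<longleftrightarrow>
     (\<exists>f. bij_betw f (verts G) (verts H) \<and>
          (\<forall>u\<in>verts G. \<forall>v\<in>verts G. {u, v} \<in> edges G \<longleftrightarrow> {f u, f v} \<in> edges H))"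

definition delete_vertex :: "'a \<Rightarrow> 'a ugraph \<Rightarrow> 'a ugraph" where
  "delete_vertex v G = \<lparr>verts = verts G - {v}, edges = {e \<in> edges G. v \<notin> e}\<rparr>"

definition delete_edge :: "'a set \<Rightarrow> 'a ugraph \<Rightarrow> 'a ugraph" where
  "delete_edge e G = \<lparr>verts = verts G, edges = edges G - {e}\<rparr>"

text \<open>
  Contracting the edge \<open>{u, v}\<close> merges \<open>v\<close> into \<open>u\<close>, which plays the role of the new vertex.
  Parallel edges coincide as sets; the resulting loop \<open>{u}\<close> is removed.
\<close>

definition contract_edge :: "'a \<Rightarrow> 'a \<Rightarrow> 'a ugraph \<Rightarrow> 'a ugraph" where
  "contract_edge u v G =
     \<lparr>verts = verts G - {v},
      edges = (\<lambda>e. (\<lambda>x. if x = v then u else x) ` e) ` edges G - {{u}}\<rparr>"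

inductive minor_step :: "'a ugraph \<Rightarrow> 'a ugraph \<Rightarrow> bool" where
  delete_vertex: "v \<in> verts G \<Longrightarrow> minor_step G (delete_vertex v G)"
| delete_edge: "e \<in> edges G \<Longrightarrow> minor_step G (delete_edge e G)"
| contract_edge: "{u, v} \<in> edges G \<Longrightarrow> minor_step G (contract_edge u v G)"

definition is_minor :: "'b ugraph \<Rightarrow> 'a ugraph \<Rightarrow> bool" where
  "is_minor H G \<longleftrightarrow> (\<exists>G'. minor_step\<^sup>*\<^sup>* G G' \<and> isomorphic G' H)"

definition complete_graph :: "nat \<Rightarrow> nat ugraph" where
  "complete_graph t = \<lparr>verts = {..<t}, edges = {e. e \<subseteq> {..<t} \<and> card e = 2}\<rparr>"

end

theory Submission
  imports Defs
begin

text \<open>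
  Put \<open>k = \<Delta>(G) + 1\<close>. A vertex of maximum degree together with its incident edges is a clique of
  size \<open>k\<close> in \<open>T(G)\<close>, so only the case that \<open>G\<close> has no total \<open>k\<close>-coloring needs work. Take a
  minimal set \<open>W\<close> of vertices such that \<open>G[W]\<close> has no total \<open>k\<close>-coloring. By the hypothesis on
  the class, some \<open>v\<close> has degree at least \<open>\<Delta>(G)\<close> in \<open>G[W]\<close>. If \<open>G[W] - v\<close> were
  disconnected, then total \<open>k\<close>-colorings of the two parts, each with \<open>v\<close> added, could be glued
  at \<open>v\<close> after permuting the colors of one of them, because \<open>v\<close> and its incident edges are at most
  \<open>k\<close> elements. Hence \<open>G[W] - v\<close> is connected, and contracting its vertices in \<open>T(G)\<close> to one
  vertex extends the clique at \<open>v\<close> to a \<open>K\<^bsub>k+1\<^esub>\<close>.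
\<close>

section \<open>Induced subgraphs, connectivity and simple graphs\<close>

definition induced_subgraph :: "'a ugraph \<Rightarrow> 'a set \<Rightarrow> 'a ugraph" where
  "induced_subgraph G W = \<lparr>verts = W, edges = {e \<in> edges G. e \<subseteq> W}\<rparr>"

text \<open>Connectivity of \<open>G[S]\<close> by cuts instead of paths: this form passes easily to
  contractions, and its negation directly supplies the two sides to be glued. Empty and one-element
  sets qualify vacuously.\<close>

definition connected_in :: "'a ugraph \<Rightarrow> 'a set \<Rightarrow> bool" where
  "connected_in G S \<longleftrightarrow>
     (\<forall>X \<subseteq> S. X \<noteq> {} \<longrightarrow> X \<noteq> S \<longrightarrow> (\<exists>x\<in>X. \<exists>y\<in>S - X. {x, y} \<in> edges G))"

lemma verts_induced_subgraph [simp]: "verts (induced_subgraph G W) = W"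
  and edges_induced_subgraph [simp]: "edges (induced_subgraph G W) = {e \<in> edges G. e \<subseteq> W}"
  by (simp_all add: induced_subgraph_def)

lemma simple_graph_finite_verts: "simple_graph G \<Longrightarrow> finite (verts G)"
  by (simp add: simple_graph_def)

lemma simple_graph_finite_edges:
  assumes "simple_graph G" shows "finite (edges G)"
proof (rule finite_subset)
  show "edges G \<subseteq> Pow (verts G)" using assms by (auto simp: simple_graph_def)
  show "finite (Pow (verts G))" using assms by (simp add: simple_graph_def)
qed

lemma simple_graph_edge_verts:
  assumes "simple_graph G" "{u, v} \<in> edges G"
  shows "u \<in> verts G" "v \<in> verts G" "u \<noteq> v"
proof -
  have "{u, v} \<subseteq> verts G" "card {u, v} = 2"
    using assms unfolding simple_graph_def by blast+
  then show "u \<in> verts G" "v \<in> verts G" "u \<noteq> v" by auto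
qed

lemma simple_graph_edge_cases:
  assumes "simple_graph G" "e \<in> edges G"
  obtains u v where "e = {u, v}" "u \<noteq> v" "u \<in> verts G" "v \<in> verts G"
proof -
  have e: "card e = 2" "e \<subseteq> verts G" using assms by (auto simp: simple_graph_def)
  then obtain u v where "e = {u, v}" "u \<noteq> v" by (auto simp: card_2_iff)
  with e that show thesis by auto
qed

lemma simple_graph_induced_subgraph:
  assumes "simple_graph G" "W \<subseteq> verts G"
  shows "simple_graph (induced_subgraph G W)"
  using assms finite_subset by (fastforce simp: simple_graph_def)

lemma subgraph_induced_subgraph:
  assumes "simple_graph G" "W \<subseteq> verts G"
  shows "subgraph (induced_subgraph G W) G"
  using simple_graph_induced_subgraph[OF assms] assms by (auto simp: subgraph_def)

lemma induced_subgraph_verts: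
  assumes "simple_graph G" shows "induced_subgraph G (verts G) = G"
proof -
  have "{e \<in> edges G. e \<subseteq> verts G} = edges G" using assms by (auto simp: simple_graph_def)
  then show ?thesis by (simp add: induced_subgraph_def)
qed

section \<open>Complete minors\<close>

lemma minor_steps_is_minor:
  "minor_step\<^sup>*\<^sup>* G G' \<Longrightarrow> is_minor H G' \<Longrightarrow> is_minor H G"
  unfolding is_minor_def by (meson rtranclp_trans)

lemma minor_steps_induced_subgraph:
  assumes "simple_graph G" "W \<subseteq> verts G"
  shows "minor_step\<^sup>*\<^sup>* G (induced_subgraph G W)"
  using assms
proof (induction "card (verts G - W)" arbitrary: G)
  case 0
  then have "W = verts G" using simple_graph_finite_verts[of G] by auto
  then show ?case using 0 by (simp add: induced_subgraph_verts)
next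
  case (Suc n)
  then obtain x where x: "x \<in> verts G" "x \<notin> W"
    by (metis DiffE Suc_neq_Zero card.empty equals0I)
  let ?G = "delete_vertex x G"
  have vG: "verts ?G - W = (verts G - W) - {x}" by (auto simp: delete_vertex_def)
  have "card (verts ?G - W) = n"
    unfolding vG using Suc.hyps(2) x by simp
  moreover have "simple_graph ?G"
    using Suc.prems(1) by (auto simp: simple_graph_def delete_vertex_def)
  moreover have "W \<subseteq> verts ?G" using Suc.prems(2) x by (auto simp: delete_vertex_def)
  ultimately have "minor_step\<^sup>*\<^sup>* ?G (induced_subgraph ?G W)"
    using Suc.hyps(1) by blast
  moreover have "induced_subgraph ?G W = induced_subgraph G W"
    using x by (auto simp: induced_subgraph_def delete_vertex_def)
  ultimately show ?case
    using minor_step.delete_vertex[OF x(1)] by (metis converse_rtranclp_into_rtranclp)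
qed

lemma isomorphic_complete_graph:
  assumes "simple_graph G"
    and complete: "\<And>u v. u \<in> verts G \<Longrightarrow> v \<in> verts G \<Longrightarrow> u \<noteq> v \<Longrightarrow> {u, v} \<in> edges G"
  shows "isomorphic G (complete_graph (card (verts G)))"
proof -
  obtain f where f: "bij_betw f (verts G) {..<card (verts G)}"
    using ex_bij_betw_finite_nat[OF simple_graph_finite_verts[OF assms(1)]]
    by (auto simp: atLeast0LessThan)
  have "{u, v} \<in> edges G \<longleftrightarrow> {f u, f v} \<in> edges (complete_graph (card (verts G)))"
    if "u \<in> verts G" "v \<in> verts G" for u v
  proof -
    have "{u, v} \<in> edges G \<longleftrightarrow> u \<noteq> v"
      using that complete simple_graph_edge_verts(3)[OF assms(1)] by auto
    also have "\<dots> \<longleftrightarrow> f u \<noteq> f v"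
      using f that by (auto simp: bij_betw_def inj_on_def)
    also have "\<dots> \<longleftrightarrow> {f u, f v} \<in> edges (complete_graph (card (verts G)))"
      using that f by (auto simp: complete_graph_def bij_betw_def card_2_iff)
    finally show ?thesis .
  qed
  then show ?thesis using f unfolding isomorphic_def complete_graph_def by auto
qed

section \<open>Edge contraction and collapsing a connected set\<close>

lemma simple_graph_contract_edge:
  assumes G: "simple_graph G" and uv: "{u, v} \<in> edges G"
  shows "simple_graph (contract_edge u v G)"
proof -
  have u: "u \<in> verts G" "u \<noteq> v" using simple_graph_edge_verts[OF G uv] by auto
  have "e \<subseteq> verts G - {v} \<and> card e = 2" if "e \<in> edges (contract_edge u v G)" for e
  proof -
    from that obtain e' where e': "e' \<in> edges G" "e = (\<lambda>x. if x = v then u else x) ` e'" "e \<noteq> {u}"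
      by (auto simp: contract_edge_def)
    obtain x y where xy: "e' = {x, y}" "x \<noteq> y" "x \<in> verts G" "y \<in> verts G"
      using simple_graph_edge_cases[OF G e'(1)] .
    define a b where "a = (if x = v then u else x)" and "b = (if y = v then u else y)"
    have e: "e = {a, b}" using e'(2) xy(1) by (simp add: a_def b_def)
    \<comment> \<open>Only the ends of \<open>{u, v}\<close> are identified, and the image of that
      edge is the removed loop \<open>{u}\<close>.\<close>
    have "a \<noteq> b" using e'(3) xy(2) unfolding e by (auto simp: a_def b_def)
    moreover have "a \<in> verts G - {v}" "b \<in> verts G - {v}" using xy u by (auto simp: a_def b_def)
    ultimately show ?thesis by (simp add: e)
  qed
  then show ?thesis
    using G by (simp add: simple_graph_def) (simp add: contract_edge_def)
qed

lemma contract_edge_edgeI: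
  assumes "{x, y} \<in> edges G" "x \<noteq> u" "x \<noteq> v"
  shows "{x, if y = v then u else y} \<in> edges (contract_edge u v G)"
proof -
  have "{x, if y = v then u else y} = (\<lambda>z. if z = v then u else z) ` {x, y}"
    using assms by auto
  moreover have "{x, if y = v then u else y} \<noteq> {u}" using assms by auto
  ultimately show ?thesis using assms(1) unfolding contract_edge_def by auto
qed

text \<open>Contract the edges inside \<open>S\<close> one at a time, by induction on
  \<open>card S\<close>. The clique \<open>A\<close> is untouched, and an element of
  \<open>A\<close> that loses its neighbor \<open>v\<close> gains \<open>u\<close> instead. Once
  \<open>S\<close> is a single vertex, the whole graph is complete.\<close>

lemma complete_minor_contract:
  assumes "simple_graph G" "verts G = A \<union> S" "A \<inter> S = {}" "S \<noteq> {}" "connected_in G S"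
    and "\<And>a b. a \<in> A \<Longrightarrow> b \<in> A \<Longrightarrow> a \<noteq> b \<Longrightarrow> {a, b} \<in> edges G"
    and "\<And>a. a \<in> A \<Longrightarrow> \<exists>s\<in>S. {a, s} \<in> edges G"
  shows "is_minor (complete_graph (Suc (card A))) G"
  using assms
proof (induction "card S" arbitrary: G S rule: less_induct)
  case less
  note G = \<open>simple_graph G\<close>
  have fin: "finite A" "finite S" using simple_graph_finite_verts[OF G] less.prems(2) by auto
  obtain u where u: "u \<in> S" using less.prems(4) by auto
  show ?case
  proof (cases "S = {u}")
    case True
    then have "card (verts G) = Suc (card A)" using less.prems(2,3) fin by auto
    moreover have "isomorphic G (complete_graph (card (verts G)))"
    proof (rule isomorphic_complete_graph[OF G])
      fix x y assume "x \<in> verts G" "y \<in> verts G" "x \<noteq> y"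
      then consider "x \<in> A" "y \<in> A" | "x \<in> A" "y = u" | "x = u" "y \<in> A"
        using True less.prems(2) by auto
      then show "{x, y} \<in> edges G"
        using less.prems(6,7) True \<open>x \<noteq> y\<close> by cases (auto simp: insert_commute[of u])
    qed
    ultimately show ?thesis unfolding is_minor_def by auto
  next
    case False
    \<comment> \<open>Connectivity applied to the cut \<open>{u}\<close> gives an edge of
      \<open>S\<close> to contract.\<close>
    then obtain v where v: "v \<in> S" "v \<noteq> u" and uv: "{u, v} \<in> edges G"
      using less.prems(5) u unfolding connected_in_def
      by (metis DiffE empty_subsetI insert_not_empty insert_subset singleton_iff)
    let ?H = "contract_edge u v G" and ?S = "S - {v}"
    have edge: "{a, if b = v then u else b} \<in> edges ?H"
      if "{a, b} \<in> edges G" "a \<noteq> u" "a \<noteq> v" for a b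
      using contract_edge_edgeI[OF that] .
    have "is_minor (complete_graph (Suc (card A))) ?H"
    proof (rule less.hyps[of ?S])
      show "card ?S < card S" using v fin by (simp add: card_gt_0_iff less.prems(4))
      show "simple_graph ?H" using simple_graph_contract_edge[OF G uv] .
      show "verts ?H = A \<union> ?S" using less.prems(2,3) v by (auto simp: contract_edge_def)
      show "A \<inter> ?S = {}" using less.prems(3) by auto
      show "?S \<noteq> {}" using u v by auto
      show "{a, b} \<in> edges ?H" if "a \<in> A" "b \<in> A" "a \<noteq> b" for a b
      proof -
        have "a \<noteq> u" "a \<noteq> v" "b \<noteq> v" using that less.prems(3) u v by auto
        then show ?thesis using edge[of a b] less.prems(6)[OF that] by auto
      qed
      show "\<exists>s\<in>?S. {a, s} \<in> edges ?H" if a: "a \<in> A" for a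
      proof -
        obtain s where s: "s \<in> S" "{a, s} \<in> edges G" using less.prems(7)[OF a] by auto
        have "a \<noteq> u" "a \<noteq> v" using that less.prems(3) u v by auto
        then have "{a, if s = v then u else s} \<in> edges ?H" using edge s by auto
        then show ?thesis using s u v by (auto split: if_splits)
      qed
      show "connected_in ?H ?S"
        unfolding connected_in_def
      proof (intro allI impI)
        fix X assume X: "X \<subseteq> ?S" "X \<noteq> {}" "X \<noteq> ?S"
        show "\<exists>x\<in>X. \<exists>y\<in>?S - X. {x, y} \<in> edges ?H"
        \<comment> \<open>The merged vertex \<open>u\<close> stands for both \<open>u\<close> and
          \<open>v\<close>, so the cut lifts to \<open>insert v X\<close> if it contains
          \<open>u\<close>, and to \<open>X\<close> itself otherwise.\<close>
        proof (cases "u \<in> X")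
          case True
          have "insert v X \<subseteq> S" "insert v X \<noteq> {}" "insert v X \<noteq> S" using X v by auto
          then obtain x y where xy: "x \<in> insert v X" "y \<in> S - insert v X" "{x, y} \<in> edges G"
            using less.prems(5) unfolding connected_in_def by meson
          \<comment> \<open>The edge is read from its outer end \<open>y\<close>, which differs from
            both \<open>u\<close> and \<open>v\<close>, so that \<open>edge\<close> applies.\<close>
          have "{y, if x = v then u else x} \<in> edges ?H"
            using xy True by (intro edge) (auto simp: insert_commute)
          then show ?thesis using xy True
            by (intro bexI[of _ "if x = v then u else x"] bexI[of _ y])
               (auto simp: insert_commute)
        next
          case False
          have "X \<subseteq> S" "X \<noteq> S" using X v by auto
          then obtain x y where xy: "x \<in> X" "y \<in> S - X" "{x, y} \<in> edges G"
            using less.prems(5) X unfolding connected_in_def by meson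
          have "x \<noteq> u" "x \<noteq> v" using xy X False by auto
          with xy(3) have "{x, if y = v then u else y} \<in> edges ?H" by (rule edge)
          then show ?thesis using xy False u v
            by (intro bexI[of _ x] bexI[of _ "if y = v then u else y"]) auto
        qed
      qed
    qed
    then show ?thesis
      using minor_steps_is_minor minor_step.contract_edge[OF uv] by blast
  qed
qed

text \<open>Deleting all vertices outside \<open>A \<union> S\<close> reduces this to the case where
  these two sets make up the whole graph.\<close>

lemma complete_minorI:
  assumes G: "simple_graph G" and sub: "A \<subseteq> verts G" "S \<subseteq> verts G"
    and "A \<inter> S = {}" "S \<noteq> {}" "connected_in G S"
    and "\<And>a b. a \<in> A \<Longrightarrow> b \<in> A \<Longrightarrow> a \<noteq> b \<Longrightarrow> {a, b} \<in> edges G"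
    and "\<And>a. a \<in> A \<Longrightarrow> \<exists>s\<in>S. {a, s} \<in> edges G"
  shows "is_minor (complete_graph (Suc (card A))) G"
proof (rule minor_steps_is_minor)
  show "minor_step\<^sup>*\<^sup>* G (induced_subgraph G (A \<union> S))"
    using minor_steps_induced_subgraph[OF G] sub by simp
  show "is_minor (complete_graph (Suc (card A))) (induced_subgraph G (A \<union> S))"
  proof (rule complete_minor_contract[where S = S])
    show "connected_in (induced_subgraph G (A \<union> S)) S"
      unfolding connected_in_def
    proof (intro allI impI)
      fix X assume X: "X \<subseteq> S" "X \<noteq> {}" "X \<noteq> S"
      then obtain x y where "x \<in> X" "y \<in> S - X" "{x, y} \<in> edges G"
        using \<open>connected_in G S\<close> unfolding connected_in_def by meson
      with X show "\<exists>x\<in>X. \<exists>y\<in>S - X. {x, y} \<in> edges (induced_subgraph G (A \<union> S))"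
        by (intro bexI[of _ x] bexI[of _ y]) auto
    qed
  qed (use assms in \<open>auto intro: simple_graph_induced_subgraph\<close>)
qed

section \<open>Total colorings\<close>

lemma simple_graph_total_graph:
  assumes G: "simple_graph G" shows "simple_graph (total_graph G)"
proof -
  have "finite (verts (total_graph G))"
    using simple_graph_finite_verts[OF G] simple_graph_finite_edges[OF G]
    by (simp add: total_graph_def)
  moreover have "e \<subseteq> verts (total_graph G) \<and> card e = 2" if "e \<in> edges (total_graph G)" for e
    using that simple_graph_edge_verts[OF G] G
    by (fastforce simp: total_graph_def simple_graph_def card_2_iff)
  ultimately show ?thesis by (simp add: simple_graph_def)
qed

lemma total_graph_edge_cases:
  assumes "E \<in> edges (total_graph G)"
  obtains u v where "E = {Inl u, Inl v}" "{u, v} \<in> edges G"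
  | e f where "E = {Inr e, Inr f}" "e \<in> edges G" "f \<in> edges G" "e \<noteq> f" "e \<inter> f \<noteq> {}"
  | v e where "E = {Inl v, Inr e}" "e \<in> edges G" "v \<in> e"
  using assms unfolding total_graph_def ugraph.select_convs by blast

text \<open>The three kinds of edges of \<open>T(G)\<close> match the three kinds of conflict in a
  total coloring. This is what bounds the chromatic number of \<open>T(G)\<close> from
  above.\<close>

lemma proper_coloring_total_graph:
  assumes "total_coloring G k c"
  shows "proper_coloring (total_graph G) k c"
  unfolding proper_coloring_def
proof (intro conjI ballI allI impI)
  fix x y assume "{x, y} \<in> edges (total_graph G)"
  then show "c x \<noteq> c y"
  proof (cases rule: total_graph_edge_cases)
    case (1 u v)
    then have "c (Inl u) \<noteq> c (Inl v)" using assms by (simp add: total_coloring_def)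
    with 1(1) show ?thesis by (auto simp: doubleton_eq_iff)
  next
    case (2 e f)
    then have "c (Inr e) \<noteq> c (Inr f)" using assms by (simp add: total_coloring_def)
    with 2(1) show ?thesis by (auto simp: doubleton_eq_iff)
  next
    case (3 v e)
    then have "c (Inl v) \<noteq> c (Inr e)" using assms by (simp add: total_coloring_def)
    with 3(1) show ?thesis by (auto simp: doubleton_eq_iff)
  qed
qed (use assms in \<open>auto simp: total_coloring_def total_graph_def\<close>)

lemma chromatic_number_total_graph_le:
  "total_coloring G k c \<Longrightarrow> chromatic_number (total_graph G) \<le> k"
  unfolding chromatic_number_def by (intro Least_le exI proper_coloring_total_graph)

lemma total_coloring_mono: "total_coloring G k c \<Longrightarrow> k \<le> l \<Longrightarrow> total_coloring G l c"
  unfolding total_coloring_def by (meson order_less_le_trans)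

text \<open>An injective numbering of all vertices and edges has no conflicts. Hence the
  \<open>LEAST\<close> in \<open>total_chromatic_number\<close> is attained.\<close>

lemma ex_total_coloring:
  assumes G: "simple_graph G" shows "\<exists>k c. total_coloring G k c"
proof -
  let ?T = "verts (total_graph G)"
  obtain f where f: "bij_betw f ?T {..<card ?T}"
    using ex_bij_betw_finite_nat[of ?T] simple_graph_finite_verts[OF simple_graph_total_graph[OF G]]
    by (auto simp: atLeast0LessThan)
  have inj: "f x \<noteq> f y" if "x \<in> ?T" "y \<in> ?T" "x \<noteq> y" for x y
    using f that by (auto simp: bij_betw_def inj_on_def)
  have less: "f x < card ?T" if "x \<in> ?T" for x
    using f that by (auto simp: bij_betw_def)
  have mem: "Inl v \<in> ?T \<longleftrightarrow> v \<in> verts G" "Inr e \<in> ?T \<longleftrightarrow> e \<in> edges G" for v e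
    by (auto simp: total_graph_def)
  have "total_coloring G (card ?T) f"
    unfolding total_coloring_def
  proof (intro conjI ballI allI impI)
    fix e v assume "e \<in> edges G" "v \<in> e"
    then have "v \<in> verts G" using G by (auto simp: simple_graph_def)
    then show "f (Inl v) \<noteq> f (Inr e)" using \<open>e \<in> edges G\<close> by (intro inj) (auto simp: mem)
  next
    fix u v assume "{u, v} \<in> edges G"
    then show "f (Inl u) \<noteq> f (Inl v)"
      using simple_graph_edge_verts[OF G] by (intro inj) (auto simp: mem)
  next
    fix e e' assume "e \<in> edges G" "e' \<in> edges G" "e \<noteq> e' \<and> e \<inter> e' \<noteq> {}"
    then show "f (Inr e) \<noteq> f (Inr e')" by (intro inj) (simp_all add: mem)
  qed (auto intro!: less simp: mem)
  then show ?thesis by blast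
qed

lemma ex_total_coloring_total_chromatic_number:
  assumes "simple_graph G" "total_chromatic_number G \<le> k"
  shows "\<exists>c. total_coloring G k c"
proof -
  have "\<exists>c. total_coloring G (total_chromatic_number G) c"
    unfolding total_chromatic_number_def using ex_total_coloring[OF assms(1)] by (rule LeastI_ex)
  then show ?thesis using assms(2) total_coloring_mono by blast
qed

section \<open>Degrees and the maximum degree\<close>

lemma degree_le_max_degree:
  assumes "simple_graph G" "v \<in> verts G" shows "degree G v \<le> max_degree G"
  using assms simple_graph_finite_verts[OF assms(1)] by (simp add: max_degree_def)

lemma ex_max_degree:
  assumes "simple_graph G" "verts G \<noteq> {}"
  obtains v where "v \<in> verts G" "degree G v = max_degree G"
proof -
  have "finite (degree G ` verts G)" using simple_graph_finite_verts[OF assms(1)] by simp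
  then have "max_degree G = Max (degree G ` verts G)"
    using assms(2) by (simp add: max_degree_def)
  with \<open>finite (degree G ` verts G)\<close> have "max_degree G \<in> degree G ` verts G"
    using assms(2) Max_in by simp
  then show thesis using that by auto
qed

lemma degree_induced_subgraph_le:
  assumes "simple_graph G" shows "degree (induced_subgraph G W) v \<le> degree G v"
  unfolding degree_def using simple_graph_finite_edges[OF assms] by (intro card_mono) auto

section \<open>Gluing total colorings at a cut vertex\<close>

text \<open>The complements of \<open>A\<close> and \<open>B\<close> in the finite set
  \<open>U\<close> have equal size, so a bijection between them completes \<open>f\<close> to a
  permutation.\<close>

lemma ex_bij_betw_extension:
  assumes "finite U" "A \<subseteq> U" "B \<subseteq> U" and f: "bij_betw f A B"
  obtains g where "bij_betw g U U" "\<And>x. x \<in> A \<Longrightarrow> g x = f x"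
proof -
  have "card (U - A) = card (U - B)"
    using assms bij_betw_same_card[OF f] by (simp add: card_Diff_subset finite_subset)
  then obtain h where h: "bij_betw h (U - A) (U - B)"
    using assms(1) finite_same_card_bij by blast
  let ?g = "\<lambda>x. if x \<in> A then f x else h x"
  have "bij_betw ?g A B" using f by (simp cong: bij_betw_cong)
  moreover have "bij_betw ?g (U - A) (U - B)"
    using h by (subst bij_betw_cong[where g = h]) auto
  ultimately have "bij_betw ?g (A \<union> (U - A)) (B \<union> (U - B))"
    by (rule bij_betw_combine) auto
  then have "bij_betw ?g U U" using assms by (simp add: Un_absorb1)
  then show thesis using that by auto
qed

text \<open>In the application \<open>U\<close> is the palette, \<open>p\<close> and
  \<open>q\<close> are the colors of the cut vertex in two colorings, and \<open>P\<close> and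
  \<open>Q\<close> are the colors of its incident edges. Besides \<open>p\<close> and
  \<open>P\<close> there are enough colors left to receive \<open>Q\<close> injectively.\<close>

lemma ex_permutation_separating:
  assumes "finite U" and sub: "P \<subseteq> U" "Q \<subseteq> U" "p \<in> U" "q \<in> U"
    and "p \<notin> P" "q \<notin> Q" and card: "card P + card Q < card U"
  obtains g where "bij_betw g U U" "g q = p" "g ` Q \<inter> P = {}"
proof -
  have fin: "finite P" "finite Q" using assms finite_subset by auto
  have "card (U - insert p P) = card U - Suc (card P)"
    using sub \<open>p \<notin> P\<close> fin by (subst card_Diff_subset) auto
  \<comment> \<open>The strict inequality reserves the one color \<open>p\<close>.\<close>
  then have "card Q \<le> card (U - insert p P)" using card by simp
  then obtain R where R: "R \<subseteq> U - insert p P" "card R = card Q"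
    using obtain_subset_with_card_n by metis
  then obtain h where h: "bij_betw h Q R"
    using fin assms(1) finite_same_card_bij by (metis finite_Diff finite_subset)
  let ?h = "h(q := p)"
  have "bij_betw ?h (insert q Q) (insert p R)"
    using h R \<open>q \<notin> Q\<close> by (auto simp: bij_betw_def inj_on_def)
  moreover have "insert p R \<subseteq> U" "insert q Q \<subseteq> U" using R sub by auto
  ultimately obtain g where g: "bij_betw g U U" "\<And>x. x \<in> insert q Q \<Longrightarrow> g x = ?h x"
    using ex_bij_betw_extension[OF assms(1)] by blast
  have "g ` Q = R" using g(2) h \<open>q \<notin> Q\<close> by (auto simp: bij_betw_def)
  then show thesis using that[OF g(1)] g(2)[of q] R by auto
qed

text \<open>All colors that occur on elements of \<open>G\<close> are below \<open>k\<close>, where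
  \<open>g\<close> is injective. Simplicity of \<open>G\<close> ensures that the ends of edges are
  among these elements.\<close>

lemma total_coloring_permute:
  assumes c: "total_coloring G k c" and g: "bij_betw g {..<k} {..<k}" and G: "simple_graph G"
  shows "total_coloring G k (g \<circ> c)"
proof -
  have inj: "g i = g j \<longleftrightarrow> i = j" if "i < k" "j < k" for i j
    using g that by (auto simp: bij_betw_def inj_on_def)
  have less: "g i < k" if "i < k" for i using g that by (auto simp: bij_betw_def)
  have V: "c (Inl v) < k" if "v \<in> verts G" for v using c that by (simp add: total_coloring_def)
  have E: "c (Inr e) < k" if "e \<in> edges G" for e using c that by (simp add: total_coloring_def)
  have sub: "v \<in> verts G" if "e \<in> edges G" "v \<in> e" for e v
    using that G by (auto simp: simple_graph_def)
  have "c (Inl u) \<noteq> c (Inl v) \<and> u \<in> verts G \<and> v \<in> verts G" if "{u, v} \<in> edges G" for u v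
    using c that simple_graph_edge_verts[OF G that] by (simp add: total_coloring_def)
  then show ?thesis
    using c unfolding total_coloring_def by (auto simp: inj less V E sub)
qed

text \<open>Edges at \<open>v\<close> pairwise meet in \<open>v\<close>, so the number of colors on
  them equals the number of edges.\<close>

lemma total_coloring_inj_on_star:
  assumes "total_coloring G k c"
  shows "inj_on (c \<circ> Inr) {e \<in> edges G. v \<in> e}"
  using assms unfolding total_coloring_def inj_on_def by fastforce

text \<open>The two sides share only \<open>v\<close>, and no edge joins \<open>X\<close> to
  \<open>Y\<close>. Once the colorings agree at \<open>v\<close>, the only possible conflicts
  between the sides are those between edges at \<open>v\<close>, and a permutation of the second
  coloring removes them.\<close>

lemma total_coloring_glue:
  assumes G: "simple_graph G" and V: "verts G = insert v (X \<union> Y)" and XY: "X \<inter> Y = {}" "v \<notin> X" "v \<notin> Y"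
    and no_edge: "\<And>x y. x \<in> X \<Longrightarrow> y \<in> Y \<Longrightarrow> {x, y} \<notin> edges G"
    and deg: "degree G v < k"
    and c1: "total_coloring (induced_subgraph G (insert v X)) k c1"
    and c2: "total_coloring (induced_subgraph G (insert v Y)) k c2"
  shows "\<exists>c. total_coloring G k c"
proof -
  let ?G1 = "induced_subgraph G (insert v X)" and ?G2 = "induced_subgraph G (insert v Y)"
  define E1 E2 where "E1 = {e \<in> edges ?G1. v \<in> e}" and "E2 = {e \<in> edges ?G2. v \<in> e}"
  have G2: "simple_graph ?G2" using simple_graph_induced_subgraph[OF G] V by auto
  \<comment> \<open>An edge within both sides would be contained in \<open>{v}\<close>, but it has
    two ends.\<close>
  have only_one: "\<not> e \<subseteq> insert v Y" if "e \<in> edges G" "e \<subseteq> insert v X" for e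
    using that XY by (auto elim!: simple_graph_edge_cases[OF G])
  have split: "e \<subseteq> insert v X \<or> e \<subseteq> insert v Y" if e: "e \<in> edges G" for e
  proof -
    obtain a b where "e = {a, b}" "a \<in> verts G" "b \<in> verts G"
      using simple_graph_edge_cases[OF G e] by metis
    then show ?thesis using no_edge[of a b] no_edge[of b a] e V by (auto simp: insert_commute)
  qed
  have finE: "finite (edges G)" using simple_graph_finite_edges[OF G] .
  \<comment> \<open>\<open>E1\<close> and \<open>E2\<close> are disjoint sets of edges of
    \<open>G\<close> at \<open>v\<close>. As the degree of \<open>v\<close> is below
    \<open>k\<close>, one color remains for \<open>v\<close> itself.\<close>
  have "card E1 + card E2 = card (E1 \<union> E2)"
    using finE only_one by (subst card_Un_disjoint) (auto simp: E1_def E2_def)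
  also have "\<dots> \<le> degree G v"
    unfolding degree_def using finE by (intro card_mono) (auto simp: E1_def E2_def)
  finally have cardE: "card E1 + card E2 < k" using deg by simp
  let ?P = "(c1 \<circ> Inr) ` E1" and ?Q = "(c2 \<circ> Inr) ` E2"
  have "card ?P = card E1" "card ?Q = card E2"
    using total_coloring_inj_on_star[OF c1, of v] total_coloring_inj_on_star[OF c2, of v]
    unfolding E1_def E2_def by (blast intro: card_image)+
  then have PQ: "card ?P + card ?Q < card {..<k}" using cardE by simp
  have P: "?P \<subseteq> {..<k}" "c1 (Inl v) \<in> {..<k}" "c1 (Inl v) \<notin> ?P"
    using c1 unfolding total_coloring_def E1_def by auto
  have Q: "?Q \<subseteq> {..<k}" "c2 (Inl v) \<in> {..<k}" "c2 (Inl v) \<notin> ?Q"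
    using c2 unfolding total_coloring_def E2_def by auto
  obtain g where g: "bij_betw g {..<k} {..<k}" "g (c2 (Inl v)) = c1 (Inl v)"
    "g ` ?Q \<inter> ?P = {}"
    using ex_permutation_separating[OF finite_lessThan P(1) Q(1) P(2) Q(2) P(3) Q(3) PQ] .
  define d where "d = g \<circ> c2"
  have d: "total_coloring ?G2 k d" unfolding d_def using total_coloring_permute[OF c2 g(1) G2] .
  have dv: "d (Inl v) = c1 (Inl v)" using g(2) by (simp add: d_def)
  have dE: "d (Inr f) \<noteq> c1 (Inr e)" if "e \<in> E1" "f \<in> E2" for e f
    using g(3) that by (auto simp: d_def)
  \<comment> \<open>Giving precedence to the first coloring is harmless: the overlap of the sides is
    just \<open>v\<close>, where \<open>c1\<close> and \<open>d\<close> agree, and no edge lies in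
    both.\<close>
  define c where "c = case_sum (\<lambda>x. if x \<in> insert v X then c1 (Inl x) else d (Inl x))
    (\<lambda>e. if e \<subseteq> insert v X then c1 (Inr e) else d (Inr e))"
  have cV1: "c (Inl x) = c1 (Inl x)" if "x \<in> insert v X" for x using that by (auto simp: c_def)
  have cV2: "c (Inl x) = d (Inl x)" if "x \<in> insert v Y" for x
    using that XY dv by (auto simp: c_def)
  have cE1: "c (Inr e) = c1 (Inr e)" if "e \<subseteq> insert v X" for e using that by (simp add: c_def)
  have cE2: "c (Inr e) = d (Inr e)" if "e \<in> edges G" "e \<subseteq> insert v Y" for e
    using that only_one by (auto simp: c_def)
  have cross: "c (Inr e) \<noteq> c (Inr f)"
    if "e \<in> edges G" "f \<in> edges G" "e \<inter> f \<noteq> {}" "e \<subseteq> insert v X" "f \<subseteq> insert v Y" for e f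
  proof -
    have "v \<in> e" "v \<in> f" using that XY by auto
    then have "e \<in> E1" "f \<in> E2" using that by (auto simp: E1_def E2_def)
    then show ?thesis using dE cE1 cE2 that by metis
  qed
  have "total_coloring G k c"
    unfolding total_coloring_def
  proof (intro conjI ballI allI impI)
    fix x assume "x \<in> verts G"
    then consider "x \<in> insert v X" | "x \<in> insert v Y" using V by auto
    then show "c (Inl x) < k"
      using c1 d by cases (auto simp: cV1 cV2 total_coloring_def)
  next
    fix e assume e: "e \<in> edges G"
    from split[OF e] show "c (Inr e) < k"
      using c1 d e cE1 cE2 by (auto simp: total_coloring_def)
  next
    fix x y assume e: "{x, y} \<in> edges G"
    from split[OF e] show "c (Inl x) \<noteq> c (Inl y)"
    proof
      assume "{x, y} \<subseteq> insert v X"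
      then show ?thesis using c1 e cV1[of x] cV1[of y] by (simp add: total_coloring_def)
    next
      assume "{x, y} \<subseteq> insert v Y"
      then show ?thesis using d e cV2[of x] cV2[of y] by (simp add: total_coloring_def)
    qed
  next
    fix e x assume e: "e \<in> edges G" and x: "x \<in> e"
    from split[OF e] show "c (Inl x) \<noteq> c (Inr e)"
    proof
      assume *: "e \<subseteq> insert v X"
      with x have "x \<in> insert v X" by auto
      with * show ?thesis using c1 e x cV1[of x] cE1[of e] by (simp add: total_coloring_def)
    next
      assume *: "e \<subseteq> insert v Y"
      with x have "x \<in> insert v Y" by auto
      with * show ?thesis using d e x cV2[of x] cE2[of e] by (simp add: total_coloring_def)
    qed
  next
    fix e f assume e: "e \<in> edges G" and f: "f \<in> edges G" and ef: "e \<noteq> f \<and> e \<inter> f \<noteq> {}"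
    from split[OF e] split[OF f] consider
        "e \<subseteq> insert v X" "f \<subseteq> insert v X" | "e \<subseteq> insert v Y" "f \<subseteq> insert v Y"
      | "e \<subseteq> insert v X" "f \<subseteq> insert v Y" | "e \<subseteq> insert v Y" "f \<subseteq> insert v X" by auto
    then show "c (Inr e) \<noteq> c (Inr f)"
    proof cases
      case 1
      then show ?thesis using c1 e f ef by (simp add: cE1 total_coloring_def)
    next
      case 2
      then show ?thesis using d e f ef by (simp add: cE2 total_coloring_def)
    next
      case 3
      then show ?thesis using cross e f ef by auto
    next
      case 4
      then show ?thesis using cross[of f e] e f ef by (simp add: Int_commute)
    qed
  qed
  then show ?thesis by blast
qed

section \<open>Hadwiger's conjecture for total graphs\<close>

definition star :: "'a ugraph \<Rightarrow> 'a \<Rightarrow> ('a + 'a set) set" where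
  "star G v = insert (Inl v) (Inr ` {e \<in> edges G. v \<in> e})"

lemma card_star:
  assumes "simple_graph G" shows "card (star G v) = Suc (degree G v)"
  using simple_graph_finite_edges[OF assms]
  by (auto simp: star_def degree_def card_image card_insert_if)

lemma star_subset: "v \<in> verts G \<Longrightarrow> star G v \<subseteq> verts (total_graph G)"
  by (auto simp: star_def total_graph_def)

lemma star_adjacent:
  assumes "a \<in> star G v" "b \<in> star G v" "a \<noteq> b"
  shows "{a, b} \<in> edges (total_graph G)"
proof -
  consider "a = Inl v" "b \<in> Inr ` {e \<in> edges G. v \<in> e}" | "b = Inl v" "a \<in> Inr ` {e \<in> edges G. v \<in> e}"
    | e f where "a = Inr e" "b = Inr f" "e \<in> edges G" "f \<in> edges G" "e \<noteq> f" "v \<in> e \<inter> f"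
    using assms unfolding star_def by auto
  then show ?thesis
  proof cases
    case 3
    then have "e \<inter> f \<noteq> {}" by auto
    with 3 show ?thesis unfolding total_graph_def by simp blast
  qed (auto simp: total_graph_def insert_commute)
qed

text \<open>The vertices of \<open>G\<close> induce a copy of \<open>G\<close> in
  \<open>T(G)\<close>, so a cut of the copy pulls back to a cut of \<open>S\<close>.\<close>

lemma connected_in_total_graph:
  assumes "connected_in G S" shows "connected_in (total_graph G) (Inl ` S)"
  unfolding connected_in_def
proof (intro allI impI)
  fix X assume X: "X \<subseteq> Inl ` S" "X \<noteq> {}" "X \<noteq> (Inl ` S :: ('a + 'a set) set)"
  then obtain X' where X': "X = Inl ` X'" "X' \<subseteq> S" by (meson subset_imageE)
  with X have "X' \<noteq> {}" "X' \<noteq> S" by auto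
  then obtain x y where "x \<in> X'" "y \<in> S - X'" "{x, y} \<in> edges G"
    using assms X' unfolding connected_in_def by meson
  then show "\<exists>x\<in>X. \<exists>y\<in>Inl ` S - X. {x, y} \<in> edges (total_graph G)"
    unfolding X' by (intro bexI[of _ "Inl x"] bexI[of _ "Inl y"]) (auto simp: total_graph_def)
qed

text \<open>Any \<open>t\<close> elements of the star form a clique. One of them is taken as the
  connected set of \<open>complete_minorI\<close>, so nothing is contracted.\<close>

lemma complete_minor_star:
  assumes G: "simple_graph G" and v: "v \<in> verts G" and t: "0 < t" "t \<le> Suc (degree G v)"
  shows "is_minor (complete_graph t) (total_graph G)"
proof -
  obtain A where A: "A \<subseteq> star G v" "card A = t" "finite A"
    using obtain_subset_with_card_n[of t "star G v"] t(2) card_star[OF G] by metis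
  then obtain s where s: "s \<in> A" using t(1) by fastforce
  have "is_minor (complete_graph (Suc (card (A - {s})))) (total_graph G)"
  proof (rule complete_minorI[where S = "{s}"])
    show "connected_in (total_graph G) {s}" unfolding connected_in_def by auto
    show "\<exists>s'\<in>{s}. {a, s'} \<in> edges (total_graph G)" if "a \<in> A - {s}" for a
      using that A(1) s star_adjacent[of a G v s] by auto
    show "{a, b} \<in> edges (total_graph G)" if "a \<in> A - {s}" "b \<in> A - {s}" "a \<noteq> b" for a b
      using that A(1) star_adjacent[of a G v b] by auto
  qed (use A s star_subset[OF v] in \<open>auto intro: simple_graph_total_graph[OF G]\<close>)
  then show ?thesis using A s by (metis card.remove)
qed

text \<open>The star of \<open>v\<close> in \<open>G[W]\<close> is a clique with degree plus one
  elements, and contracting \<open>W - {v}\<close> adds one more vertex. An edge at \<open>v\<close>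
  is adjacent to it through its other end, and \<open>v\<close> through any neighbor.\<close>

lemma complete_minor_connected_remainder:
  assumes G: "simple_graph G" and W: "W \<subseteq> verts G" "v \<in> W"
    and conn: "connected_in G (W - {v})"
    and deg: "0 < degree (induced_subgraph G W) v"
    and t: "0 < t" "t \<le> degree (induced_subgraph G W) v + 2"
  shows "is_minor (complete_graph t) (total_graph G)"
proof -
  let ?H = "induced_subgraph G W"
  have H: "simple_graph ?H" using simple_graph_induced_subgraph[OF G W(1)] .
  have star: "star ?H v \<subseteq> star G v" by (auto simp: star_def)
  have nb: "\<exists>w \<in> W - {v}. w \<in> e \<and> {v, w} = e" if e: "e \<in> edges ?H" "v \<in> e" for e
  proof -
    obtain x y where "e = {x, y}" "x \<noteq> y" "x \<in> W" "y \<in> W"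
      using simple_graph_edge_cases[OF H e(1)] by auto
    with e(2) show ?thesis by auto
  qed
  \<comment> \<open>The positive degree yields a neighbor \<open>w\<close>, which makes
    \<open>W - {v}\<close> nonempty and adjacent to \<open>Inl v\<close>.\<close>
  have "{e \<in> edges ?H. v \<in> e} \<noteq> {}" using deg unfolding degree_def by (metis card.empty less_irrefl)
  then obtain e where e: "e \<in> edges ?H" "v \<in> e" by auto
  obtain w where w: "w \<in> W - {v}" "{v, w} = e" using nb[OF e] by auto
  have adj: "\<exists>s \<in> Inl ` (W - {v}). {a, s} \<in> edges (total_graph G)" if a: "a \<in> star ?H v" for a
  proof -
    consider "a = Inl v" | f where "a = Inr f" "f \<in> edges ?H" "v \<in> f"
      using a unfolding star_def by auto
    then show ?thesis
    proof cases
      case 1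
      then show ?thesis using w e by (intro bexI[of _ "Inl w"]) (auto simp: total_graph_def)
    next
      case 2
      then obtain z where "z \<in> W - {v}" "z \<in> f" using nb by metis
      with 2 show ?thesis
        by (intro bexI[of _ "Inl z"]) (auto simp: total_graph_def insert_commute)
    qed
  qed
  \<comment> \<open>One of the \<open>t\<close> vertices of the minor comes from the contracted set,
    so the star supplies \<open>t - 1\<close>.\<close>
  have "t - 1 \<le> card (star ?H v)" using t card_star[OF H] by simp
  then obtain A where A: "A \<subseteq> star ?H v" "card A = t - 1"
    using obtain_subset_with_card_n by metis
  have "is_minor (complete_graph (Suc (card A))) (total_graph G)"
  proof (rule complete_minorI[where S = "Inl ` (W - {v})"])
    show "A \<subseteq> verts (total_graph G)" using A star star_subset[of v G] W by auto
    show "Inl ` (W - {v}) \<subseteq> verts (total_graph G)" using W by (auto simp: total_graph_def)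
    show "A \<inter> Inl ` (W - {v}) = {}" using A by (auto simp: star_def)
    show "{a, b} \<in> edges (total_graph G)" if "a \<in> A" "b \<in> A" "a \<noteq> b" for a b
      using that A star star_adjacent[of a G v b] by blast
  qed (use w A adj in \<open>auto intro: simple_graph_total_graph[OF G] connected_in_total_graph[OF conn]\<close>)
  then show ?thesis using A t by simp
qed

text \<open>A cut of the remaining vertices yields two proper vertex subsets containing
  \<open>v\<close>. Both are colorable by criticality, and gluing the colorings at \<open>v\<close>
  would color \<open>G\<close>.\<close>

lemma connected_in_critical:
  assumes G: "simple_graph G" and v: "v \<in> verts G" and deg: "degree G v < k"
    and crit: "\<And>W. W \<subset> verts G \<Longrightarrow> \<exists>c. total_coloring (induced_subgraph G W) k c"
    and none: "\<nexists>c. total_coloring G k c"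
  shows "connected_in G (verts G - {v})"
proof (rule ccontr)
  assume "\<not> connected_in G (verts G - {v})"
  then obtain X where X: "X \<subseteq> verts G - {v}" "X \<noteq> {}" "X \<noteq> verts G - {v}"
    and no_edge: "\<And>x y. x \<in> X \<Longrightarrow> y \<in> verts G - {v} - X \<Longrightarrow> {x, y} \<notin> edges G"
    unfolding connected_in_def by blast
  let ?Y = "verts G - {v} - X"
  have "insert v X \<subset> verts G" "insert v ?Y \<subset> verts G" using X v by auto
  then obtain c1 c2 where "total_coloring (induced_subgraph G (insert v X)) k c1"
    "total_coloring (induced_subgraph G (insert v ?Y)) k c2"
    using crit by meson
  moreover have "verts G = insert v (X \<union> ?Y)" "X \<inter> ?Y = {}" "v \<notin> X" "v \<notin> ?Y"
    using X v by auto
  ultimately have "\<exists>c. total_coloring G k c"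
    using total_coloring_glue[OF G, of v X ?Y k] no_edge deg by blast
  with none show False ..
qed

theorem theorem7:
  fixes \<F> :: "'a ugraph set"
  assumes simple: "\<And>G. G \<in> \<F> \<Longrightarrow> simple_graph G"
    and closed: "subgraph_closed \<F>"
    and total: "\<And>G. G \<in> \<F> \<Longrightarrow> total_chromatic_number G \<le> max_degree G + 2"
  shows "\<forall>H \<in> total_graph ` \<F>. \<forall>t::nat. t > 0 \<longrightarrow> chromatic_number H \<ge> t \<longrightarrow>
           is_minor (complete_graph t) H"
proof (intro ballI allI impI)
  fix H :: "('a + 'a set) ugraph" and t :: nat
  assume "H \<in> total_graph ` \<F>" and t: "0 < t" "t \<le> chromatic_number H"
  then obtain G where GF: "G \<in> \<F>" and H: "H = total_graph G" by auto
  note G = simple[OF GF]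
  define k where "k = Suc (max_degree G)"
  show "is_minor (complete_graph t) H"
  proof (cases "\<exists>c. total_coloring G k c")
    case True
    \<comment> \<open>The null graph has maximum degree 0 with no vertex attaining it. It is
      excluded because its total graph needs 0 colors, fewer than \<open>t\<close>.\<close>
    have "verts G \<noteq> {}"
    proof
      assume "verts G = {}"
      then have "total_coloring G 0 (\<lambda>_. 0)"
        using G by (auto simp: total_coloring_def simple_graph_def)
      then show False using chromatic_number_total_graph_le t H by fastforce
    qed
    then obtain v where "v \<in> verts G" "degree G v = max_degree G"
      using ex_max_degree[OF G] by metis
    moreover have "t \<le> k" using True chromatic_number_total_graph_le t H by fastforce
    ultimately show ?thesis unfolding H k_def using complete_minor_star[OF G] t by simp
  next
    case False
    have "\<exists>W. W \<subseteq> verts G \<and> (\<nexists>c. total_coloring (induced_subgraph G W) k c)"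
      using False induced_subgraph_verts[OF G] by (metis subset_refl)
    \<comment> \<open>\<open>W\<close> is chosen of least cardinality, so every proper subset of it
      induces a colorable graph.\<close>
    then obtain W where W: "W \<subseteq> verts G" "\<nexists>c. total_coloring (induced_subgraph G W) k c"
      and min: "\<And>W'. W' \<subseteq> verts G \<Longrightarrow> (\<nexists>c. total_coloring (induced_subgraph G W') k c) \<Longrightarrow> card W \<le> card W'"
      using exists_least_iff[of "\<lambda>n. \<exists>W. card W = n \<and> W \<subseteq> verts G \<and> (\<nexists>c. total_coloring (induced_subgraph G W) k c)"]
      by (metis linorder_not_less)
    let ?H = "induced_subgraph G W"
    have sH: "simple_graph ?H" using simple_graph_induced_subgraph[OF G W(1)] .
    have HF: "?H \<in> \<F>"
      using closed GF subgraph_induced_subgraph[OF G W(1)] unfolding subgraph_closed_def by blast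
    have finW: "finite W" using simple_graph_finite_verts[OF sH] by simp
    have deg_le: "degree ?H x \<le> max_degree G" if "x \<in> verts G" for x
      using degree_induced_subgraph_le[OF G] degree_le_max_degree[OF G that] by (rule order_trans)
    have "W \<noteq> {}"
    proof
      assume "W = {}"
      then have "total_coloring ?H k (\<lambda>_. 0)"
        using sH by (auto simp: total_coloring_def simple_graph_def)
      then show False using W(2) by blast
    qed
    then obtain v where v: "v \<in> W" "degree ?H v = max_degree ?H"
      using ex_max_degree[OF sH] by auto
    \<comment> \<open>Closure under subgraphs lets the coloring bound apply to \<open>?H\<close>. If
      its maximum degree were below that of \<open>G\<close>, then \<open>k\<close> colors would
      suffice for \<open>?H\<close>.\<close>
    have "\<not> max_degree ?H + 2 \<le> k"
      using ex_total_coloring_total_chromatic_number[OF sH] total[OF HF] W(2) order_trans by blast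
    then have deg: "max_degree G \<le> degree ?H v" using v by (simp add: k_def)
    \<comment> \<open>Otherwise \<open>?H\<close> has no edges, and a single color suffices;
      \<open>k\<close> is at least 1.\<close>
    have "0 < degree ?H v"
    proof (rule ccontr)
      assume "\<not> 0 < degree ?H v"
      then have deg0: "degree ?H x = 0" if "x \<in> W" for x
        using degree_le_max_degree[OF sH, of x] v that by simp
      have "edges ?H = {}"
      proof (rule equals0I)
        fix e assume e: "e \<in> edges ?H"
        obtain x where x: "x \<in> e" "x \<in> W" using simple_graph_edge_cases[OF sH e] by auto
        have "finite {f \<in> edges ?H. x \<in> f}"
          by (rule finite_subset[OF Collect_restrict simple_graph_finite_edges[OF sH]])
        then have "{f \<in> edges ?H. x \<in> f} = {}"
          using deg0[OF x(2)] unfolding degree_def by (rule card_0_eq[THEN iffD1])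
        with e x show False by blast
      qed
      then have "total_coloring ?H k (\<lambda>_. 0)"
        unfolding total_coloring_def by (auto simp: k_def)
      then show False using W(2) by blast
    qed
    moreover have "connected_in G (W - {v})"
    proof -
      have "connected_in ?H (verts ?H - {v})"
      proof (rule connected_in_critical[OF sH _ _ _ W(2)])
        show "v \<in> verts ?H" using v by simp
        show "degree ?H v < k" using deg_le[of v] v(1) W(1) by (auto simp: k_def less_Suc_eq_le)
        fix W' assume W': "W' \<subset> verts ?H"
        then have "induced_subgraph ?H W' = induced_subgraph G W'"
          by (auto simp: induced_subgraph_def)
        moreover have "card W' < card W" using W' finW by (simp add: psubset_card_mono)
        ultimately show "\<exists>c. total_coloring (induced_subgraph ?H W') k c"
          using min[of W'] W W' by fastforce
      qed
      then show ?thesis unfolding connected_in_def by simp blast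
    qed
    moreover have "t \<le> degree ?H v + 2"
    proof -
      \<comment> \<open>Here the coloring bound is applied to \<open>G\<close> itself, which limits
        \<open>t\<close> to the size of the minor available at \<open>v\<close>.\<close>
      obtain c where "total_coloring G (max_degree G + 2) c"
        using ex_total_coloring_total_chromatic_number[OF G total[OF GF]] by blast
      then show ?thesis using chromatic_number_total_graph_le t H deg by fastforce
    qed
    ultimately show ?thesis
      unfolding H using complete_minor_connected_remainder[OF G W(1) v(1)] t(1) by blast
  qed
qed

end
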